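(* Let $Q(x,y)=Q_{\mathcal{T}}(x,y;t)$ be the complete generating function of quarter-plane walks with steps from $\mathcal{T}=\{(-1,1),(0,1),(1,-1)\}$. Then, as formal power series in $t$, $$Q(x,0)=\frac{1}{x^2t}\sum_{n\ge0}(-1)^nA_n(x)A_{n+1}(x),\qquad Q(0,y)=\frac{1}{y^2t}\sum_{n\ge0}(-1)^nB_n(y)B_{n+1}(y),$$ $$Q(1,1)=\frac{1}{1-3t}\left(1-\sum_{n\ge0}(-1)^nA_n(1)A_{n+1}(1)-\sum_{n\ge0}(-1)^nB_n(1)B_{n+1}(1)\right).$$
   Context: A walk in the quarter plane with step set $\mathcal{T}$ is a sequence of lattice points starting at $(0,0)$, all in $\mathbb{N}^2$, with consecutive differences in $\mathcal{T}$; $Q_{\mathcal{T}}(x,y;t)=\sum q_{n,i,j}x^iy^jt^n$ where $q_{n,i,j}$ counts such walks of length $n$ ending at $(i,j)$. Let $K(x,y)=xy-t(xy^2+x^2+y^2)$. Let $Y_1(x)=\frac{x}{2t(1+x)}\left(1-\sqrt{1-4t^2(1+x)}\right)$ be the root of $K(x,y)=0$ in $y$ that is a formal power series in $t$, and $X_1(y)=\frac{y}{2t}\left(1-ty-\sqrt{(1-ty)^2-4t^2}\right)$ the root of $K(x,y)=0$ in $x$ that is a formal power series in $t$. Define $A_0(x)=x$, $A_{2k+1}=Y_1(A_{2k})$, $A_{2k+2}=X_1(A_{2k+1})$, and $B_0(y)=y$, $B_{2k+1}=X_1(B_{2k})$, $B_{2k+2}=Y_1(B_{2k+1})$. *)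

theory Defs
  imports "HOL-Computational_Algebra.Computational_Algebra" "HOL-Library.Product_Plus"
begin

definition quarter_plane_walk :: "(int \<times> int) set \<Rightarrow> (int \<times> int) list \<Rightarrow> bool" where
  "quarter_plane_walk T w \<longleftrightarrow>
     w \<noteq> [] \<and> hd w = (0, 0) \<and> (\<forall>(i, j) \<in> set w. 0 \<le> i \<and> 0 \<le> j) \<and>
     (\<forall>k. Suc k < length w \<longrightarrow> w ! Suc k - w ! k \<in> T)"

text \<open>The length of a walk is its number of steps, so a walk of length \<open>n\<close> has \<open>n + 1\<close> points.\<close>

definition walk_count :: "(int \<times> int) set \<Rightarrow> nat \<Rightarrow> nat \<Rightarrow> nat \<Rightarrow> nat" where
  "walk_count T n i j =
     card {w. quarter_plane_walk T w \<and> length w = Suc n \<and> last w = (int i, int j)}"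

text \<open>
  The generating function is a power series in \<open>t = fps_X\<close>. Its arguments \<open>x\<close> and \<open>y\<close> range over
  the coefficient ring: they may be indeterminates of that ring or specialised values. For finite
  \<open>T\<close> each coefficient is a finite sum, see \<open>finite_walk_support\<close> below.
\<close>

definition walk_gf :: "(int \<times> int) set \<Rightarrow> 'a::comm_semiring_1 \<Rightarrow> 'a \<Rightarrow> 'a fps" where
  "walk_gf T x y =
     Abs_fps (\<lambda>n. \<Sum>(i, j) | walk_count T n i j \<noteq> 0. of_nat (walk_count T n i j) * x ^ i * y ^ j)"

definition steps :: "(int \<times> int) set" where
  "steps = {(-1, 1), (0, 1), (1, -1)}"

definition kernel :: "'a::comm_ring_1 fps \<Rightarrow> 'a fps \<Rightarrow> 'a fps" where
  "kernel x y = x * y - fps_X * (x * y\<^sup>2 + x\<^sup>2 + y\<^sup>2)"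

text \<open>The square root, with constant coefficient 1, of a series with constant coefficient 1.\<close>

definition fps_sqrt1 :: "'a::field_char_0 fps \<Rightarrow> 'a fps" where
  "fps_sqrt1 f = fps_radical (\<lambda>_ _. 1) 2 f"

text \<open>
  \<open>Y1\<close> and \<open>X1\<close> take a power series in \<open>t\<close> as argument, so that they can be composed. Division of
  power series discards terms of negative degree; as the numerators below are multiples of \<open>t\<close>, the
  quotients are exact (whenever \<open>1 + x\<close> is invertible), cf. \<open>kernel_Y1\<close> and \<open>kernel_X1\<close>.
\<close>

definition Y1 :: "'a::field_char_0 fps \<Rightarrow> 'a fps" where
  "Y1 x = (x * (1 - fps_sqrt1 (1 - 4 * fps_X\<^sup>2 * (1 + x)))) / (2 * fps_X * (1 + x))"

definition X1 :: "'a::field_char_0 fps \<Rightarrow> 'a fps" where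
  "X1 y = (y * (1 - fps_X * y - fps_sqrt1 ((1 - fps_X * y)\<^sup>2 - 4 * fps_X\<^sup>2))) / (2 * fps_X)"

primrec A :: "'a::field_char_0 \<Rightarrow> nat \<Rightarrow> 'a fps" where
  "A x 0 = fps_const x"
| "A x (Suc n) = (if even n then Y1 (A x n) else X1 (A x n))"

primrec B :: "'a::field_char_0 \<Rightarrow> nat \<Rightarrow> 'a fps" where
  "B y 0 = fps_const y"
| "B y (Suc n) = (if even n then X1 (B y n) else Y1 (B y n))"

text \<open>The indeterminates of the field of rational functions in two variables over the rationals.\<close>

definition x_var :: "rat poly poly fract" where
  "x_var = to_fract [:[:0, 1:]:]"

definition y_var :: "rat poly poly fract" where
  "y_var = to_fract [:0, 1:]"


lemma finite_walks:
  assumes "finite T"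
  shows "finite {w. quarter_plane_walk T w \<and> length w = Suc n}"
proof (induction n)
  case 0
  have "{w. quarter_plane_walk T w \<and> length w = Suc 0} \<subseteq> {[(0, 0)]}"
    by (auto simp: quarter_plane_walk_def length_Suc_conv)
  then show ?case
    by (rule finite_subset) simp
next
  case (Suc n)
  let ?W = "\<lambda>n. {w. quarter_plane_walk T w \<and> length w = Suc n}"
  have "?W (Suc n) \<subseteq> (\<lambda>(w, s). w @ [last w + s]) ` (?W n \<times> T)"
  proof
    fix w
    assume w: "w \<in> ?W (Suc n)"
    define v where "v = butlast w"
    have lw: "length w = Suc (Suc n)"
      using w by simp
    have lv: "length v = Suc n"
      using lw by (simp add: v_def)
    have wv: "w = v @ [last w]"
      using lw by (cases w rule: rev_cases) (auto simp: v_def)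
    have nth: "v ! k = w ! k" if "k < Suc n" for k
      using that lv by (metis wv nth_append)
    have vne: "v \<noteq> []"
      using lv by auto
    have "quarter_plane_walk T v"
      unfolding quarter_plane_walk_def
    proof (intro conjI allI impI)
      show "hd v = (0, 0)"
        using w vne wv by (metis (mono_tags, lifting) hd_append2 mem_Collect_eq quarter_plane_walk_def)
      show "\<forall>(i, j) \<in> set v. 0 \<le> i \<and> 0 \<le> j"
        using w by (auto simp: quarter_plane_walk_def v_def dest: in_set_butlastD)
      show "v ! Suc k - v ! k \<in> T" if "Suc k < length v" for k
        using that w nth[of k] nth[of "Suc k"] lv by (simp add: quarter_plane_walk_def)
    qed (use vne in simp)
    moreover have "last w - last v \<in> T"
    proof -
      have "w \<noteq> []"
        using lw by auto
      then have "last w = w ! Suc n" "last v = w ! n"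
        using lw lv vne nth[of n] by (simp_all add: last_conv_nth)
      then show ?thesis
        using w by (simp add: quarter_plane_walk_def)
    qed
    ultimately show "w \<in> (\<lambda>(w, s). w @ [last w + s]) ` (?W n \<times> T)"
      using lv by (intro image_eqI[where x = "(v, last w - last v)"]) (simp_all add: wv[symmetric])
  qed
  then show ?case
    by (rule finite_subset) (use Suc assms in auto)
qed

lemma finite_walk_support:
  assumes "finite T"
  shows "finite {(i, j). walk_count T n i j \<noteq> 0}"
proof -
  let ?W = "{w. quarter_plane_walk T w \<and> length w = Suc n}"
  have "{(i, j). walk_count T n i j \<noteq> 0} \<subseteq> (\<lambda>w. (nat (fst (last w)), nat (snd (last w)))) ` ?W"
  proof clarify
    fix i j
    assume "0 < walk_count T n i j"
    then obtain w where "w \<in> ?W" "last w = (int i, int j)"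
      by (auto simp: walk_count_def card_gt_0_iff)
    then show "(i, j) \<in> (\<lambda>w. (nat (fst (last w)), nat (snd (last w)))) ` ?W"
      by (intro image_eqI[where x = w]) auto
  qed
  then show ?thesis
    by (rule finite_subset) (use finite_walks[OF assms] in blast)
qed

lemma fps_X_dvd:
  fixes f :: "'a::comm_ring_1 fps"
  assumes "f $ 0 = 0"
  shows "fps_X dvd f"
proof (rule dvdI)
  show "f = fps_X * fps_shift 1 f"
    using assms by (auto simp: fps_eq_iff)
qed

lemma fps_sqrt1_nth_0: "fps_sqrt1 f $ 0 = 1"
  by (simp add: fps_sqrt1_def)

lemma fps_sqrt1_square:
  assumes "f $ 0 = 1"
  shows "(fps_sqrt1 f)\<^sup>2 = f"
  using power_radical[of f "\<lambda>_ _. 1" 1] assms by (simp add: fps_sqrt1_def numeral_2_eq_2)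

lemma Y1_exact:
  assumes "(1 + x) $ 0 \<noteq> 0"
  shows "2 * fps_X * (1 + x) * Y1 x = x * (1 - fps_sqrt1 (1 - 4 * fps_X\<^sup>2 * (1 + x)))"
proof -
  let ?r = "fps_sqrt1 (1 - 4 * fps_X\<^sup>2 * (1 + x))"
  have "fps_X dvd 1 - ?r"
    by (rule fps_X_dvd) (simp add: fps_sqrt1_nth_0)
  moreover have "is_unit (2 * (1 + x))"
  proof -
    have "(2 * (1 + x)) $ 0 = 2 * (1 + x) $ 0"
      by (simp add: numeral_fps_const)
    then show ?thesis
      using assms by (simp add: fps_is_unit_iff del: fps_add_nth)
  qed
  ultimately have "2 * fps_X * (1 + x) dvd x * (1 - ?r)"
    using mult_unit_dvd_iff[of "2 * (1 + x)" fps_X "x * (1 - ?r)"] by (simp add: ac_simps)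
  then show ?thesis
    by (simp add: Y1_def)
qed

lemma X1_exact:
  "2 * fps_X * X1 y = y * (1 - fps_X * y - fps_sqrt1 ((1 - fps_X * y)\<^sup>2 - 4 * fps_X\<^sup>2))"
proof -
  let ?r = "fps_sqrt1 ((1 - fps_X * y)\<^sup>2 - 4 * fps_X\<^sup>2)"
  have "fps_X dvd 1 - fps_X * y - ?r"
    by (rule fps_X_dvd) (simp add: fps_sqrt1_nth_0)
  moreover have "is_unit (2 :: 'a fps)"
    by (simp add: fps_is_unit_iff numeral_fps_const)
  ultimately have "2 * fps_X dvd y * (1 - fps_X * y - ?r)"
    using mult_unit_dvd_iff[of 2 fps_X "y * (1 - fps_X * y - ?r)"] by (simp add: mult.commute)
  then show ?thesis
    by (simp add: X1_def)
qed

lemma kernel_Y1: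
  assumes "(1 + x) $ 0 \<noteq> 0"
  shows "kernel x (Y1 x) = 0"
proof -
  let ?r = "fps_sqrt1 (1 - 4 * fps_X\<^sup>2 * (1 + x))"
  have r: "?r\<^sup>2 = 1 - 4 * fps_X\<^sup>2 * (1 + x)"
    by (rule fps_sqrt1_square) simp
  have "4 * fps_X * (1 + x) * kernel x (Y1 x) = 0"
    using r Y1_exact[OF assms] unfolding kernel_def by algebra
  moreover have "1 + x \<noteq> 0"
    using assms by (metis fps_zero_nth)
  ultimately show ?thesis
    by simp
qed

lemma kernel_X1: "kernel (X1 y) y = 0"
proof -
  let ?r = "fps_sqrt1 ((1 - fps_X * y)\<^sup>2 - 4 * fps_X\<^sup>2)"
  have r: "?r\<^sup>2 = (1 - fps_X * y)\<^sup>2 - 4 * fps_X\<^sup>2"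
    by (rule fps_sqrt1_square) (simp add: fps_nth_power_0)
  have "4 * fps_X * kernel (X1 y) y = 0"
    using r X1_exact[of y] unfolding kernel_def by algebra
  then show ?thesis
    by simp
qed

lemma Y1_unique:
  assumes "x \<noteq> 0" "1 + x \<noteq> 0"
  shows "kernel (fps_const x) y = 0 \<longleftrightarrow> y = Y1 (fps_const x)"
proof
  let ?x = "fps_const x" and ?z = "Y1 (fps_const x)"
  assume "kernel ?x y = 0"
  moreover have "kernel ?x ?z = 0"
    by (rule kernel_Y1) (use assms in simp)
  ultimately have "(y - ?z) * (fps_X * ((1 + ?x) * (y + ?z)) - ?x) = 0"
    unfolding kernel_def by algebra
  moreover have "(fps_X * ((1 + ?x) * (y + ?z)) - ?x) $ 0 \<noteq> 0"
    using assms by simp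
  ultimately show "y = ?z"
    by (metis eq_iff_diff_eq_0 fps_zero_nth mult_eq_0_iff)
qed (use assms in \<open>simp add: kernel_Y1\<close>)

lemma X1_unique:
  assumes "y \<noteq> 0"
  shows "kernel x (fps_const y) = 0 \<longleftrightarrow> x = X1 (fps_const y)"
proof
  let ?y = "fps_const y" and ?z = "X1 (fps_const y)"
  assume "kernel x ?y = 0"
  moreover have "kernel ?z ?y = 0"
    by (rule kernel_X1)
  ultimately have "(x - ?z) * (fps_X * (x + ?z + ?y\<^sup>2) - ?y) = 0"
    unfolding kernel_def by algebra
  moreover have "(fps_X * (x + ?z + ?y\<^sup>2) - ?y) $ 0 \<noteq> 0"
    using assms by simp
  ultimately show "x = ?z"
    by (metis eq_iff_diff_eq_0 fps_zero_nth mult_eq_0_iff)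
qed (simp add: kernel_X1)

end

theory Submission
  imports Defs
begin

text \<open>
  Decomposing a walk by its last step gives the functional equation
  \<open>K(x,y) Q(x,y) = xy - R(x) - S(y)\<close> with \<open>R(x) = t x\<^sup>2 Q(x,0)\<close> and \<open>S(y) = t y\<^sup>2 Q(0,y)\<close>. Consecutive
  terms of the sequences \<open>A\<close> and \<open>B\<close> annihilate the kernel, so that \<open>A\<^sub>n A\<^sub>n\<^sub>+\<^sub>1\<close> is the sum of the values
  of \<open>R\<close> and \<open>S\<close> (in the appropriate order) at \<open>A\<^sub>n\<close> and \<open>A\<^sub>n\<^sub>+\<^sub>1\<close>, and the alternating sum telescopes.
  The remainder tends to 0 because \<open>A\<^sub>n\<close> is divisible by \<open>t\<^sup>n\<close>.

  To avoid substituting power series into \<open>Q\<close>, everything is done with the partial sums of \<open>Q\<close> of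
  degree less than \<open>N\<close> in \<open>t\<close>, whose coefficients are polynomials in \<open>x\<close> and \<open>y\<close>; the telescoping
  then holds modulo \<open>t\<^sup>N\<close>.
\<close>

section \<open>Walks by last step\<close>

definition walks :: "(int \<times> int) set \<Rightarrow> nat \<Rightarrow> (int \<times> int) list set" where
  "walks T n = {w. quarter_plane_walk T w \<and> length w = Suc n}"

text \<open>Summing over walks rather than endpoints suits the decomposition by last step. The
  arguments may lie in any commutative semiring, so they may themselves be power series.\<close>

definition endpoint_poly :: "(int \<times> int) set \<Rightarrow> nat \<Rightarrow> 'a::comm_semiring_1 \<Rightarrow> 'a \<Rightarrow> 'a" where
  "endpoint_poly T n u v = (\<Sum>w\<in>walks T n. u ^ nat (fst (last w)) * v ^ nat (snd (last w)))"

lemma last_walk_nonneg: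
  assumes "w \<in> walks T n"
  shows "0 \<le> fst (last w)" "0 \<le> snd (last w)"
proof -
  have "last w \<in> set w" and "\<forall>(i, j) \<in> set w. 0 \<le> i \<and> 0 \<le> j"
    using assms by (auto simp: walks_def quarter_plane_walk_def)
  then show "0 \<le> fst (last w)" "0 \<le> snd (last w)"
    by (auto simp: case_prod_beta)
qed

lemma walk_gf_nth:
  assumes "finite T"
  shows "walk_gf T x y $ n = endpoint_poly T n x y"
proof -
  let ?S = "{(i, j). walk_count T n i j \<noteq> 0}"
  let ?e = "\<lambda>w. (nat (fst (last w)), nat (snd (last w)))"
  have fin: "finite (walks T n)"
    unfolding walks_def by (rule finite_walks[OF assms])
  \<comment> \<open>Endpoints have nonnegative coordinates, so \<open>nat\<close> is injective on
    them and the fibres of \<open>?e\<close> are the sets counted by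
    \<open>walk_count\<close>.\<close>
  have fibre: "{w. quarter_plane_walk T w \<and> length w = Suc n \<and> last w = (int i, int j)}
      = {w \<in> walks T n. ?e w = (i, j)}" for i j
    using last_walk_nonneg[of _ T n] by (force simp: walks_def prod_eq_iff)
  have count: "walk_count T n i j = card {w \<in> walks T n. ?e w = (i, j)}" for i j
    unfolding walk_count_def fibre ..
  have "?e ` walks T n \<subseteq> ?S"
  proof (rule image_subsetI)
    fix w assume "w \<in> walks T n"
    then have "w \<in> {w' \<in> walks T n. ?e w' = ?e w}"
      by simp
    then show "?e w \<in> ?S"
      using fin by (auto simp: count)
  qed
  then have "endpoint_poly T n x y =
      (\<Sum>p\<in>?S. \<Sum>w | w \<in> walks T n \<and> ?e w = p. x ^ nat (fst (last w)) * y ^ nat (snd (last w)))"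
    unfolding endpoint_poly_def
    by (intro sum.group[symmetric] fin finite_walk_support assms)
  also have "\<dots> = (\<Sum>(i, j)\<in>?S. of_nat (walk_count T n i j) * x ^ i * y ^ j)"
    by (intro sum.cong refl) (auto simp: count mult.assoc)
  finally show ?thesis
    by (simp add: walk_gf_def)
qed

lemma quarter_plane_walk_snoc:
  assumes "w \<noteq> []"
  shows "quarter_plane_walk T (w @ [p]) \<longleftrightarrow>
    quarter_plane_walk T w \<and> 0 \<le> fst p \<and> 0 \<le> snd p \<and> p - last w \<in> T"
proof -
  have "(\<forall>k. Suc k < length (w @ [p]) \<longrightarrow> (w @ [p]) ! Suc k - (w @ [p]) ! k \<in> T) \<longleftrightarrow>
      (\<forall>k. Suc k < length w \<longrightarrow> w ! Suc k - w ! k \<in> T) \<and> p - last w \<in> T" (is "?L \<longleftrightarrow> ?R")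
  proof
    assume L: ?L
    have "p - last w \<in> T"
      using L[rule_format, of "length w - 1"] assms by (simp add: nth_append last_conv_nth)
    moreover have "w ! Suc k - w ! k \<in> T" if "Suc k < length w" for k
      using L[rule_format, of k] that by (simp add: nth_append)
    ultimately show ?R by blast
  next
    assume R: ?R
    show ?L
    proof (intro allI impI)
      fix k assume k: "Suc k < length (w @ [p])"
      show "(w @ [p]) ! Suc k - (w @ [p]) ! k \<in> T"
      proof (cases "Suc k = length w")
        case True
        then have "k = length w - 1" by simp
        then show ?thesis
          using R True assms by (simp add: nth_append last_conv_nth)
      next
        case False
        then show ?thesis
          using R k by (simp add: nth_append)
      qed
    qed
  qed
  then show ?thesis
    using assms unfolding quarter_plane_walk_def by auto
qed

lemma bij_betw_walks_Suc:
  "bij_betw (\<lambda>(w, s). w @ [last w + s])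
     (SIGMA w:walks T n. {s \<in> T. 0 \<le> fst (last w + s) \<and> 0 \<le> snd (last w + s)}) (walks T (Suc n))"
proof (rule bij_betwI[where g = "\<lambda>w. (butlast w, last w - last (butlast w))"])
  show "(\<lambda>(w, s). w @ [last w + s]) \<in>
      (SIGMA w:walks T n. {s \<in> T. 0 \<le> fst (last w + s) \<and> 0 \<le> snd (last w + s)}) \<rightarrow> walks T (Suc n)"
  proof clarify
    fix w s1 s2
    assume w: "w \<in> walks T n" and "(s1, s2) \<in> T"
      "0 \<le> fst (last w + (s1, s2))" "0 \<le> snd (last w + (s1, s2))"
    moreover from w have "w \<noteq> []"
      by (auto simp: walks_def)
    ultimately show "w @ [last w + (s1, s2)] \<in> walks T (Suc n)"
      by (simp add: walks_def quarter_plane_walk_snoc)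
  qed
  show "(\<lambda>w. (butlast w, last w - last (butlast w))) \<in> walks T (Suc n) \<rightarrow>
      (SIGMA w:walks T n. {s \<in> T. 0 \<le> fst (last w + s) \<and> 0 \<le> snd (last w + s)})"
  proof
    fix w assume w: "w \<in> walks T (Suc n)"
    then obtain v p where "w = v @ [p]"
      by (cases w rule: rev_cases) (auto simp: walks_def)
    moreover from this w have "v \<noteq> []"
      by (auto simp: walks_def)
    ultimately show "(butlast w, last w - last (butlast w)) \<in>
        (SIGMA w:walks T n. {s \<in> T. 0 \<le> fst (last w + s) \<and> 0 \<le> snd (last w + s)})"
      using w by (simp add: walks_def quarter_plane_walk_snoc)
  qed
  show "(\<lambda>w. (butlast w, last w - last (butlast w))) (case p of (w, s) \<Rightarrow> w @ [last w + s]) = p"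
    if "p \<in> (SIGMA w:walks T n. {s \<in> T. 0 \<le> fst (last w + s) \<and> 0 \<le> snd (last w + s)})" for p
    by (cases p) simp
  show "(case (butlast w, last w - last (butlast w)) of (w, s) \<Rightarrow> w @ [last w + s]) = w"
    if "w \<in> walks T (Suc n)" for w
    using that by (cases w rule: rev_cases) (auto simp: walks_def)
qed

lemma endpoint_poly_0: "endpoint_poly T 0 u v = 1"
proof -
  have "walks T 0 = {[(0, 0)]}"
    by (auto simp: walks_def quarter_plane_walk_def length_Suc_conv)
  then show ?thesis
    by (simp add: endpoint_poly_def)
qed

text \<open>The factor \<open>u * v\<close> clears the negative exponents: the steps (-1,1), (0,1),
  (1,-1) contribute \<open>v\<^sup>2\<close>, \<open>u * v\<^sup>2\<close>,
  \<open>u\<^sup>2\<close>. The first is forbidden exactly when the walk ends on the vertical axis,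
  the third when it ends on the horizontal axis. Since \<open>0 ^ 0 = 1\<close>, substituting 0 for
  \<open>u\<close> or \<open>v\<close> singles out these walks.\<close>

lemma endpoint_poly_Suc:
  fixes u v :: "'a::comm_ring_1"
  shows "u * v * endpoint_poly steps (Suc n) u v =
    (u * v\<^sup>2 + u\<^sup>2 + v\<^sup>2) * endpoint_poly steps n u v
      - v\<^sup>2 * endpoint_poly steps n 0 v - u\<^sup>2 * endpoint_poly steps n u 0"
proof -
  have fin: "finite (walks steps n)"
    unfolding walks_def by (rule finite_walks) (simp add: steps_def)
  let ?m = "\<lambda>u v p. u ^ nat (fst p) * v ^ nat (snd p)"
  let ?V = "\<lambda>w. {s \<in> steps. 0 \<le> fst (last w + s) \<and> 0 \<le> snd (last w + s)}"
  have "endpoint_poly steps (Suc n) u v = (\<Sum>(w, s)\<in>(SIGMA w:walks steps n. ?V w). ?m u v (last w + s))"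
    unfolding endpoint_poly_def
    by (subst sum.reindex_bij_betw[OF bij_betw_walks_Suc, symmetric]) (simp add: case_prod_beta)
  also have "\<dots> = (\<Sum>w\<in>walks steps n. \<Sum>s\<in>?V w. ?m u v (last w + s))"
    by (rule sum.Sigma[symmetric]) (use fin in \<open>auto simp: steps_def\<close>)
  finally have "u * v * endpoint_poly steps (Suc n) u v =
      (\<Sum>w\<in>walks steps n. u * v * (\<Sum>s\<in>?V w. ?m u v (last w + s)))"
    by (simp add: sum_distrib_left)
  also have "\<dots> = (\<Sum>w\<in>walks steps n. (u * v\<^sup>2 + u\<^sup>2 + v\<^sup>2) * ?m u v (last w)
      - v\<^sup>2 * ?m 0 v (last w) - u\<^sup>2 * ?m u 0 (last w))"
  proof (rule sum.cong[OF refl])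
    fix w assume "w \<in> walks steps n"
    from last_walk_nonneg[OF this] obtain i j where ij: "last w = (int i, int j)"
      by (metis nonneg_int_cases prod.collapse)
    have "(\<Sum>s\<in>?V w. ?m u v (last w + s)) =
        (\<Sum>s\<in>steps. if 0 \<le> fst (last w + s) \<and> 0 \<le> snd (last w + s) then ?m u v (last w + s) else 0)"
      by (rule sum.inter_filter) (simp add: steps_def)
    \<comment> \<open>One summand per step, in the order of the definition of \<open>steps\<close>.
      The guards are essential: at 0 the natural subtraction would yield exponent 0 instead of a
      forbidden step.\<close>
    also have "\<dots> = (if i = 0 then 0 else u ^ (i - 1) * v ^ Suc j) + u ^ i * v ^ Suc j
        + (if j = 0 then 0 else u ^ Suc i * v ^ (j - 1))"
      by (auto simp: steps_def ij nat_add_distrib nat_diff_distrib algebra_simps)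
    finally have inner: "(\<Sum>s\<in>?V w. ?m u v (last w + s)) = \<dots>" .
    show "u * v * (\<Sum>s\<in>?V w. ?m u v (last w + s)) = (u * v\<^sup>2 + u\<^sup>2 + v\<^sup>2) * ?m u v (last w)
      - v\<^sup>2 * ?m 0 v (last w) - u\<^sup>2 * ?m u 0 (last w)"
      unfolding inner unfolding ij fst_conv snd_conv nat_int
      by (cases i; cases j) (simp_all add: power2_eq_square algebra_simps)
  qed
  also have "\<dots> = (u * v\<^sup>2 + u\<^sup>2 + v\<^sup>2) * endpoint_poly steps n u v
      - v\<^sup>2 * endpoint_poly steps n 0 v - u\<^sup>2 * endpoint_poly steps n u 0"
    by (simp add: endpoint_poly_def sum_subtractf sum_distrib_left)
  finally show ?thesis .
qed

lemma endpoint_poly_fps_const: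
  "endpoint_poly T n (fps_const x) (fps_const y) = fps_const (endpoint_poly T n x y)"
proof -
  have "(\<Sum>w\<in>W. fps_const (f w)) = fps_const (\<Sum>w\<in>W. f w)" for W and f :: "(int \<times> int) list \<Rightarrow> 'a"
    by (induction W rule: infinite_finite_induct) simp_all
  then show ?thesis
    by (simp add: endpoint_poly_def)
qed

section \<open>The functional equation\<close>

text \<open>A finite sum can be evaluated at any power series, even one with nonzero constant
  coefficient, without a question of convergence.\<close>

definition gf_trunc :: "nat \<Rightarrow> 'a::comm_ring_1 fps \<Rightarrow> 'a fps \<Rightarrow> 'a fps" where
  "gf_trunc N u v = (\<Sum>n<N. fps_X ^ n * endpoint_poly steps n u v)"

text \<open>A further step costs one power of t, so the truncation orders on the two sides differ by
  one. The isolated \<open>u * v\<close> comes from the empty walk.\<close>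

lemma gf_trunc_functional_eq:
  "u * v * gf_trunc (Suc N) u v = u * v + fps_X * (u * v\<^sup>2 + u\<^sup>2 + v\<^sup>2) * gf_trunc N u v
     - fps_X * v\<^sup>2 * gf_trunc N 0 v - fps_X * u\<^sup>2 * gf_trunc N u 0"
proof (induction N)
  case 0
  then show ?case
    by (simp add: gf_trunc_def endpoint_poly_0)
next
  case (Suc N)
  have "u * v * gf_trunc (Suc (Suc N)) u v = u * v * gf_trunc (Suc N) u v
      + fps_X ^ Suc N * (u * v * endpoint_poly steps (Suc N) u v)"
    by (simp add: gf_trunc_def algebra_simps)
  also have "\<dots> = u * v + fps_X * (u * v\<^sup>2 + u\<^sup>2 + v\<^sup>2) * gf_trunc (Suc N) u v
     - fps_X * v\<^sup>2 * gf_trunc (Suc N) 0 v - fps_X * u\<^sup>2 * gf_trunc (Suc N) u 0"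
    unfolding Suc.IH endpoint_poly_Suc by (simp add: gf_trunc_def algebra_simps)
  finally show ?case .
qed

text \<open>When the kernel vanishes, the coefficient of \<open>gf_trunc N u v\<close> in the
  functional equation is \<open>u * v\<close>. What survives besides the boundary terms is the
  difference of two consecutive truncations, a single multiple of t^N.\<close>

lemma kernel_zero_cong:
  assumes "kernel u v = 0"
  shows "fps_X ^ N dvd u * v - (fps_X * u\<^sup>2 * gf_trunc N u 0 + fps_X * v\<^sup>2 * gf_trunc N 0 v)"
proof
  have K: "fps_X * (u * v\<^sup>2 + u\<^sup>2 + v\<^sup>2) = u * v"
    using assms by (simp add: kernel_def)
  have "gf_trunc (Suc N) u v = gf_trunc N u v + fps_X ^ N * endpoint_poly steps N u v"
    by (simp add: gf_trunc_def)
  then have "u * v * gf_trunc N u v + fps_X ^ N * (u * v * endpoint_poly steps N u v) =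
      u * v + u * v * gf_trunc N u v - fps_X * v\<^sup>2 * gf_trunc N 0 v - fps_X * u\<^sup>2 * gf_trunc N u 0"
    using gf_trunc_functional_eq[of u v N] unfolding K by (simp add: distrib_left mult.left_commute)
  then show "u * v - (fps_X * u\<^sup>2 * gf_trunc N u 0 + fps_X * v\<^sup>2 * gf_trunc N 0 v)
      = fps_X ^ N * (u * v * endpoint_poly steps N u v)"
    by (simp add: diff_diff_eq add_diff_eq eq_diff_eq diff_eq_eq add.assoc) (simp add: ac_simps)
qed

lemma fps_X_power_dvd_nth:
  fixes f :: "'a::comm_semiring_1 fps"
  assumes "fps_X ^ n dvd f" "k < n"
  shows "f $ k = 0"
  using assms by (auto simp: dvd_def fps_X_power_mult_nth)

lemma gf_trunc_nth:
  assumes "k < N"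
  shows "gf_trunc N (fps_const x) (fps_const y) $ k = walk_gf steps x y $ k"
proof -
  have "gf_trunc N (fps_const x) (fps_const y) $ k =
      (\<Sum>n<N. if n = k then endpoint_poly steps n x y else 0)"
    unfolding gf_trunc_def endpoint_poly_fps_const fps_sum_nth
    by (intro sum.cong) (auto simp: fps_X_power_mult_nth)
  then show ?thesis
    using assms by (simp add: walk_gf_nth steps_def)
qed

text \<open>This untruncated version for constant arguments reduces Q(1,1) to the two boundary
  series.\<close>

lemma walk_gf_functional_eq:
  fixes x y :: "'a::comm_ring_1"
  shows "kernel (fps_const x) (fps_const y) * walk_gf steps x y = fps_const (x * y)
    - fps_X * fps_const (y\<^sup>2) * walk_gf steps 0 y - fps_X * fps_const (x\<^sup>2) * walk_gf steps x 0"
proof -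
  have "fps_const (x * y) * walk_gf steps x y = fps_const (x * y)
      + fps_X * (fps_const (x * y\<^sup>2 + x\<^sup>2 + y\<^sup>2) * walk_gf steps x y
        - fps_const (y\<^sup>2) * walk_gf steps 0 y - fps_const (x\<^sup>2) * walk_gf steps x 0)" (is "?l = ?r")
  proof (rule fps_ext)
    fix n
    show "?l $ n = ?r $ n"
      \<comment> \<open>The recursion serves positive \<open>n\<close>; at 0 both sides reduce to
        the contribution of the empty walk.\<close>
      using endpoint_poly_Suc[of x y "n - 1"]
      by (cases n) (simp_all add: walk_gf_nth steps_def endpoint_poly_0)
  qed
  then show ?thesis
    unfolding kernel_def by (simp add: algebra_simps flip: fps_const_mult fps_const_add fps_const_power)
qed

section \<open>Telescoping\<close>

lemma alternating_telescope_dvd: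
  fixes d :: "'a::comm_ring_1"
  assumes "\<And>n. d dvd c n - (h n + h (Suc n))"
  shows "d dvd h 0 - (\<Sum>n<M. (-1) ^ n * c n) - (-1) ^ M * h M"
proof (induction M)
  case 0
  then show ?case by simp
next
  case (Suc M)
  have "h 0 - (\<Sum>n<Suc M. (-1) ^ n * c n) - (-1) ^ Suc M * h (Suc M) =
      (h 0 - (\<Sum>n<M. (-1) ^ n * c n) - (-1) ^ M * h M) - (-1) ^ M * (c M - (h M + h (Suc M)))"
    by (simp add: algebra_simps)
  then show ?case
    using Suc.IH assms[of M] by (simp only: dvd_diff dvd_mult)
qed

text \<open>Here \<open>h N n\<close> plays the role of the boundary term at index \<open>n\<close>,
  known to precision \<open>N\<close> in t.\<close>

lemma alternating_sums_fps:
  fixes c :: "nat \<Rightarrow> 'a::comm_ring_1 fps"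
  assumes step: "\<And>N n. fps_X ^ N dvd c n - (h N n + h N (Suc n))"
    and rest: "\<And>N n. fps_X ^ n dvd h N n"
    and init: "\<And>N k. k < N \<Longrightarrow> h N 0 $ k = L $ k"
  shows "(\<lambda>n. (-1) ^ n * c n) sums L"
  unfolding sums_def
proof (rule tendsto_fpsI)
  fix k
  show "eventually (\<lambda>M. (\<Sum>n<M. (-1) ^ n * c n) $ k = L $ k) sequentially"
    using eventually_gt_at_top[of k]
  proof eventually_elim
    case (elim M)
    \<comment> \<open>The precision is chosen equal to the number of summands, so that the
      telescoping error and the remainder \<open>h M M\<close> are both divisible by t^M.\<close>
    have "fps_X ^ M dvd h M 0 - (\<Sum>n<M. (-1) ^ n * c n) - (-1) ^ M * h M M"
      by (rule alternating_telescope_dvd) (rule step)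
    then have "fps_X ^ M dvd (h M 0 - (\<Sum>n<M. (-1) ^ n * c n) - (-1) ^ M * h M M) + (-1) ^ M * h M M"
      by (intro dvd_add dvd_mult rest)
    then have "fps_X ^ M dvd h M 0 - (\<Sum>n<M. (-1) ^ n * c n)"
      by simp
    from fps_X_power_dvd_nth[OF this elim] show ?case
      using init[OF elim] by simp
  qed
qed

section \<open>Orders of vanishing and kernel relations along the sequences \<open>A\<close> and
  \<open>B\<close>\<close>

lemma Y1_dvd:
  assumes "(1 + x) $ 0 \<noteq> 0"
  shows "fps_X * x dvd Y1 x"
proof -
  let ?r = "fps_sqrt1 (1 - 4 * fps_X\<^sup>2 * (1 + x))"
  have r: "?r\<^sup>2 = 1 - 4 * fps_X\<^sup>2 * (1 + x)"
    by (rule fps_sqrt1_square) simp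
  \<comment> \<open>Rationalising the numerator with the conjugate \<open>1 + ?r\<close>, a unit
    with constant coefficient 2, exposes the factor \<open>fps_X * x\<close>.\<close>
  have "2 * fps_X * (1 + x) * (Y1 x * (1 + ?r) - 2 * fps_X * x) = 0"
    using r Y1_exact[OF assms] by algebra
  moreover have "1 + x \<noteq> 0"
    using assms by (metis fps_zero_nth)
  ultimately have "Y1 x * (1 + ?r) = 2 * (fps_X * x)"
    by simp
  then have "fps_X * x dvd Y1 x * (1 + ?r)"
    by simp
  moreover have "is_unit (1 + ?r)"
    by (simp add: fps_is_unit_iff fps_sqrt1_nth_0)
  ultimately show ?thesis
    by (simp add: dvd_mult_unit_iff)
qed

lemma X1_dvd: "fps_X * y dvd X1 y"
proof -
  let ?r = "fps_sqrt1 ((1 - fps_X * y)\<^sup>2 - 4 * fps_X\<^sup>2)"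
  have r: "?r\<^sup>2 = (1 - fps_X * y)\<^sup>2 - 4 * fps_X\<^sup>2"
    by (rule fps_sqrt1_square) (simp add: fps_nth_power_0)
  \<comment> \<open>The conjugate is now \<open>1 - fps_X * y + ?r\<close>, again with constant
    coefficient 2.\<close>
  have "2 * fps_X * (X1 y * (1 - fps_X * y + ?r) - 2 * fps_X * y) = 0"
    using r X1_exact[of y] by algebra
  then have "X1 y * (1 - fps_X * y + ?r) = 2 * (fps_X * y)"
    by simp
  then have "fps_X * y dvd X1 y * (1 - fps_X * y + ?r)"
    by simp
  moreover have "is_unit (1 - fps_X * y + ?r)"
    by (simp add: fps_is_unit_iff fps_sqrt1_nth_0)
  ultimately show ?thesis
    by (simp add: dvd_mult_unit_iff)
qed

lemma one_plus_nth_0: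
  fixes f :: "'a::comm_ring_1 fps"
  assumes "fps_X ^ n dvd f" "n > 0"
  shows "(1 + f) $ 0 = 1"
  using fps_X_power_dvd_nth[OF assms] by simp

text \<open>Each application of \<open>Y1\<close> or \<open>X1\<close> gains a factor t. The
  invertibility of \<open>1 + A x n\<close> comes from the hypothesis at index 0, and from the
  divisibility already proved at later indices.\<close>

lemma A_dvd:
  assumes "1 + x \<noteq> 0"
  shows "fps_X ^ n dvd A x n"
proof (induction n)
  case (Suc n)
  have "(1 + A x n) $ 0 \<noteq> 0"
    using assms one_plus_nth_0[OF Suc.IH] by (cases "n = 0") auto
  then have "fps_X * A x n dvd A x (Suc n)"
    using Y1_dvd[of "A x n"] X1_dvd[of "A x n"] by simp
  moreover have "fps_X ^ Suc n dvd fps_X * A x n"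
    using Suc.IH by (simp add: mult_dvd_mono)
  ultimately show ?case
    by (rule dvd_trans[rotated])
qed simp

text \<open>\<open>Y1\<close> acts only at odd indices, where the induction hypothesis makes the
  constant coefficient of \<open>1 + B y n\<close> equal to 1.\<close>

lemma B_dvd: "fps_X ^ n dvd B y n"
proof (induction n)
  case (Suc n)
  have "(1 + B y n) $ 0 \<noteq> 0" if "odd n"
    using one_plus_nth_0[OF Suc.IH] that by (cases "n = 0") auto
  then have "fps_X * B y n dvd B y (Suc n)"
    using Y1_dvd[of "B y n"] X1_dvd[of "B y n"] by simp
  moreover have "fps_X ^ Suc n dvd fps_X * B y n"
    using Suc.IH by (simp add: mult_dvd_mono)
  ultimately show ?case
    by (rule dvd_trans[rotated])
qed simp

lemma kernel_A:
  assumes "1 + x \<noteq> 0"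
  shows "even n \<Longrightarrow> kernel (A x n) (A x (Suc n)) = 0" "odd n \<Longrightarrow> kernel (A x (Suc n)) (A x n) = 0"
proof -
  have "(1 + A x n) $ 0 \<noteq> 0"
    using assms one_plus_nth_0[OF A_dvd[OF assms, of n]] by (cases "n = 0") auto
  then show "even n \<Longrightarrow> kernel (A x n) (A x (Suc n)) = 0" "odd n \<Longrightarrow> kernel (A x (Suc n)) (A x n) = 0"
    by (simp_all add: kernel_Y1 kernel_X1)
qed

lemma kernel_B:
  "even n \<Longrightarrow> kernel (B y (Suc n)) (B y n) = 0" "odd n \<Longrightarrow> kernel (B y n) (B y (Suc n)) = 0"
proof -
  have "(1 + B y n) $ 0 \<noteq> 0" if "odd n"
    using one_plus_nth_0[OF B_dvd[of n y]] that by (cases "n = 0") auto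
  then show "even n \<Longrightarrow> kernel (B y (Suc n)) (B y n) = 0" "odd n \<Longrightarrow> kernel (B y n) (B y (Suc n)) = 0"
    by (simp_all add: kernel_Y1 kernel_X1)
qed

lemma A_sums:
  assumes "1 + x \<noteq> 0"
  shows "(\<lambda>n. (-1) ^ n * (A x n * A x (Suc n))) sums (fps_X * fps_const (x\<^sup>2) * walk_gf steps x 0)"
proof (rule alternating_sums_fps)
  \<comment> \<open>In the kernel relations, even-indexed terms are first coordinates and
    odd-indexed terms second ones, so truncations of R and S alternate.\<close>
  let ?h = "\<lambda>N n. if even n then fps_X * (A x n)\<^sup>2 * gf_trunc N (A x n) 0
    else fps_X * (A x n)\<^sup>2 * gf_trunc N 0 (A x n)"
  show "fps_X ^ N dvd A x n * A x (Suc n) - (?h N n + ?h N (Suc n))" for N n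
  proof (cases "even n")
    case True
    then show ?thesis
      using kernel_zero_cong[OF kernel_A(1)[OF assms True]] by (simp del: A.simps)
  next
    case False
    then show ?thesis
      using kernel_zero_cong[OF kernel_A(2)[OF assms False]] by (simp del: A.simps add: ac_simps)
  qed
  show "fps_X ^ n dvd ?h N n" for N n
    using A_dvd[OF assms, of n] by (simp add: power2_eq_square)
  \<comment> \<open>The outer \<open>fps_X\<close> shifts the coefficient to index
    \<open>k - 1\<close>; at index 0 both sides vanish.\<close>
  show "?h N 0 $ k = (fps_X * fps_const (x\<^sup>2) * walk_gf steps x 0) $ k" if "k < N" for N k
    using that gf_trunc_nth[of "k - 1" N x 0] by (simp add: mult.assoc)
qed

lemma B_sums:
  "(\<lambda>n. (-1) ^ n * (B y n * B y (Suc n))) sums (fps_X * fps_const (y\<^sup>2) * walk_gf steps 0 y)"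
proof (rule alternating_sums_fps)
  \<comment> \<open>The coordinates swap roles: the sequence starts from y, so even indices carry
    S.\<close>
  let ?h = "\<lambda>N n. if even n then fps_X * (B y n)\<^sup>2 * gf_trunc N 0 (B y n)
    else fps_X * (B y n)\<^sup>2 * gf_trunc N (B y n) 0"
  show "fps_X ^ N dvd B y n * B y (Suc n) - (?h N n + ?h N (Suc n))" for N n
  proof (cases "even n")
    case True
    then show ?thesis
      using kernel_zero_cong[OF kernel_B(1)[OF True]] by (simp del: B.simps add: ac_simps)
  next
    case False
    then show ?thesis
      using kernel_zero_cong[OF kernel_B(2)[OF False]] by (simp del: B.simps add: ac_simps)
  qed
  show "fps_X ^ n dvd ?h N n" for N n
    using B_dvd[of n y] by (simp add: power2_eq_square)
  show "?h N 0 $ k = (fps_X * fps_const (y\<^sup>2) * walk_gf steps 0 y) $ k" if "k < N" for N k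
    using that gf_trunc_nth[of "k - 1" N 0 y] by (simp add: mult.assoc)
qed

section \<open>Division by the prefactors and the final formulas\<close>

lemma fps_to_fls_divide_X:
  fixes F G :: "'a::field fps"
  assumes "F = fps_X * fps_const c * G" "c \<noteq> 0"
  shows "fps_to_fls G = 1 / (fls_const c * fls_X) * fps_to_fls F"
proof -
  have "fps_to_fls F = fls_const c * fls_X * fps_to_fls G"
    unfolding assms(1) by (simp add: fls_times_fps_to_fls mult.commute)
  \<comment> \<open>Among Laurent series \<open>fls_X\<close> is invertible, so this division
    discards no terms.\<close>
  then show ?thesis
    using assms(2) by (simp add: fls_const_nonzero)
qed

lemma x_var_nonzero: "x_var \<noteq> 0" "1 + x_var \<noteq> 0"
proof -
  show "x_var \<noteq> 0"
    by (simp add: x_var_def)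
  have "1 + x_var = to_fract (1 + [:[:0, 1:]:])"
    unfolding x_var_def by (simp only: to_fract_add to_fract_1)
  also have "\<dots> \<noteq> 0"
    by (simp add: one_pCons)
  finally show "1 + x_var \<noteq> 0" .
qed

lemma y_var_nonzero: "y_var \<noteq> 0"
  by (simp add: y_var_def)

theorem theorem4:
  "summable (\<lambda>n. (-1) ^ n * A x_var n * A x_var (n + 1)) \<and>
   fps_to_fls (walk_gf steps x_var 0) =
     1 / (fls_const (x_var\<^sup>2) * fls_X)
       * fps_to_fls (\<Sum>n. (-1) ^ n * A x_var n * A x_var (n + 1)) \<and>
   summable (\<lambda>n. (-1) ^ n * B y_var n * B y_var (n + 1)) \<and>
   fps_to_fls (walk_gf steps 0 y_var) =
     1 / (fls_const (y_var\<^sup>2) * fls_X)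
       * fps_to_fls (\<Sum>n. (-1) ^ n * B y_var n * B y_var (n + 1)) \<and>
   summable (\<lambda>n. (-1) ^ n * A (1::rat) n * A 1 (n + 1)) \<and>
   summable (\<lambda>n. (-1) ^ n * B (1::rat) n * B 1 (n + 1)) \<and>
   walk_gf steps (1::rat) 1 =
     1 / (1 - 3 * fps_X)
       * (1 - (\<Sum>n. (-1) ^ n * A 1 n * A 1 (n + 1))
            - (\<Sum>n. (-1) ^ n * B 1 n * B 1 (n + 1)))"
proof -
  note Ax = A_sums[OF x_var_nonzero(2), unfolded mult.assoc[symmetric] Suc_eq_plus1]
  note By = B_sums[of y_var, unfolded mult.assoc[symmetric] Suc_eq_plus1]
  have "1 + 1 \<noteq> (0::rat)" by simp
  note A1 = A_sums[OF this, unfolded mult.assoc[symmetric] Suc_eq_plus1]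
  note B1 = B_sums[of "1::rat", unfolded mult.assoc[symmetric] Suc_eq_plus1]
  \<comment> \<open>At x = y = 1 the kernel is 1 - 3t, and the two sums are R(1) and S(1).\<close>
  have "(1 - 3 * fps_X) * walk_gf steps (1::rat) 1 =
      1 - (\<Sum>n. (-1) ^ n * A 1 n * A 1 (n + 1)) - (\<Sum>n. (-1) ^ n * B 1 n * B 1 (n + 1))"
    unfolding sums_unique[OF A1, symmetric] sums_unique[OF B1, symmetric]
    using walk_gf_functional_eq[of "1::rat" 1] by (simp add: kernel_def algebra_simps)
  moreover have "walk_gf steps (1::rat) 1 = 1 / (1 - 3 * fps_X) * ((1 - 3 * fps_X) * walk_gf steps 1 1)"
  proof -
    \<comment> \<open>The quotient of power series is exact because 1 - 3t is a unit.\<close>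
    have "1 / (1 - 3 * fps_X) * (1 - 3 * fps_X) = (1 :: rat fps)"
      by (rule dvd_div_mult_self) simp
    then show ?thesis
      by (simp only: mult.assoc[symmetric] mult_1)
  qed
  ultimately have "walk_gf steps (1::rat) 1 = 1 / (1 - 3 * fps_X) *
      (1 - (\<Sum>n. (-1) ^ n * A 1 n * A 1 (n + 1)) - (\<Sum>n. (-1) ^ n * B 1 n * B 1 (n + 1)))"
    by (simp only:)
  moreover note sums_summable[OF Ax] sums_summable[OF By] sums_summable[OF A1] sums_summable[OF B1]
  moreover have "x_var\<^sup>2 \<noteq> 0" "y_var\<^sup>2 \<noteq> 0"
    using x_var_nonzero y_var_nonzero by simp_all
  note fps_to_fls_divide_X[OF sums_unique[OF Ax, symmetric] this(1)]
    fps_to_fls_divide_X[OF sums_unique[OF By, symmetric] this(2)]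
  ultimately show ?thesis
    by (intro conjI)
qed

end
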